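(* Let $G$ be a finitely generated group and let $X$ be a compact metric space. If a continuous action $(X,G)$ of $G$ on $X$ is both distal and expansive, then $X$ is finite.
   Context: $G$ is regarded as a discrete group. A continuous action $(X,G)$ of $G$ on a compact metric space $(X,d)$ is a group homomorphism $\phi\colon G\to \mathrm{Homeo}(X)$; write $gx=\phi(g)(x)$. Two points $x,y\in X$ are proximal if $\inf_{g\in G} d(gx,gy)=0$; the action is distal if $\inf_{g\in G} d(gx,gy)>0$ for all $x\neq y$ in $X$. The action is expansive if there is a constant $c>0$ such that $\sup_{g\in G} d(gx,gy)>c$ for all $x\neq y$ in $X$. *)

theory Defs
  imports "HOL-Analysis.Abstract_Metric_Spaces" "HOL-Algebra.Bij" "HOL-Algebra.Generated_Groups"
begin

definition finitely_generated_group :: "('g, 'm) monoid_scheme \<Rightarrow> bool" where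
  "finitely_generated_group G \<longleftrightarrow>
     group G \<and> (\<exists>S. finite S \<and> S \<subseteq> carrier G \<and> generate G S = carrier G)"

text \<open>Elements of \<^const>\<open>BijGroup\<close> are bijections of the underlying set extended by
  \<^const>\<open>undefined\<close> outside of it, so that equality in the group is equality of maps on the space.\<close>

definition homeo_group :: "'a topology \<Rightarrow> ('a \<Rightarrow> 'a) monoid" where
  "homeo_group T =
     (BijGroup (topspace T))\<lparr>carrier := {f \<in> Bij (topspace T). homeomorphic_map T T f}\<rparr>"

text \<open>The acting group is discrete, so continuity of the action means precisely that every group
  element acts as a homeomorphism.\<close>

definition continuous_action ::
    "('g, 'm) monoid_scheme \<Rightarrow> 'a topology \<Rightarrow> ('g \<Rightarrow> 'a \<Rightarrow> 'a) \<Rightarrow> bool" where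
  "continuous_action G T \<phi> \<longleftrightarrow> group G \<and> \<phi> \<in> hom G (homeo_group T)"

definition distal_action ::
    "('g, 'm) monoid_scheme \<Rightarrow> 'a set \<Rightarrow> ('a \<Rightarrow> 'a \<Rightarrow> real) \<Rightarrow> ('g \<Rightarrow> 'a \<Rightarrow> 'a) \<Rightarrow> bool" where
  "distal_action G X d \<phi> \<longleftrightarrow>
     (\<forall>x\<in>X. \<forall>y\<in>X. x \<noteq> y \<longrightarrow> (INF g\<in>carrier G. d (\<phi> g x) (\<phi> g y)) > 0)"

text \<open>The supremum is taken in \<^typ>\<open>real\<close>, hence meaningful only for bounded orbits of pairs; this is
  automatic for an action on a compact metric space.\<close>

definition expansive_action ::
    "('g, 'm) monoid_scheme \<Rightarrow> 'a set \<Rightarrow> ('a \<Rightarrow> 'a \<Rightarrow> real) \<Rightarrow> ('g \<Rightarrow> 'a \<Rightarrow> 'a) \<Rightarrow> bool" where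
  "expansive_action G X d \<phi> \<longleftrightarrow>
     (\<exists>c>0. \<forall>x\<in>X. \<forall>y\<in>X. x \<noteq> y \<longrightarrow> (SUP g\<in>carrier G. d (\<phi> g x) (\<phi> g y)) > c)"

end

theory Submission
  imports Defs
begin

text \<open>Let \<open>c\<close> be an expansivity constant and call \<open>x, y\<close> \<open>n\<close>-close if no word of length
  \<open>n\<close> in the generators moves them more than \<open>c\<close> apart. If \<open>X\<close> is infinite, there
  are distinct \<open>n\<close>-close points for every \<open>n\<close>. Applying to such a pair the letters of a shortest
  word that separates it, one arrives at a pair \<open>q\<^sub>n\<close> at distance more than \<open>c\<close>. For
  \<open>k \<le> n\<close>, undoing the last \<open>k + 1\<close> letters makes the pair \<open>k\<close>-close again, hence uniformly near
  for large \<open>k\<close>. The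
  letters undone lie in a finite ball that does not depend on \<open>n\<close>, so a limit of the \<open>q\<^sub>n\<close> is a
  proximal pair of distinct points, contradicting distality.\<close>

section \<open>Word balls\<close>

text \<open>This is the ball of radius \<open>n\<close> only if \<open>S\<close> contains the identity.\<close>

primrec word_ball :: "('g, 'm) monoid_scheme \<Rightarrow> 'g set \<Rightarrow> nat \<Rightarrow> 'g set" where
  "word_ball G S 0 = {\<one>\<^bsub>G\<^esub>}"
| "word_ball G S (Suc n) = S <#>\<^bsub>G\<^esub> word_ball G S n"

context group
begin

lemma word_ball_closed: "S \<subseteq> carrier G \<Longrightarrow> word_ball G S n \<subseteq> carrier G"
  by (induction n) (simp_all add: set_mult_closed)

lemma finite_word_ball: "finite S \<Longrightarrow> finite (word_ball G S n)"
  by (induction n) (auto simp: set_mult_def)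

lemma word_ball_add:
  assumes "S \<subseteq> carrier G"
  shows "word_ball G S (m + n) = word_ball G S m <#> word_ball G S n"
proof (induction m)
  case 0
  show ?case
    using word_ball_closed[OF assms, of n] by (force simp: set_mult_def)
next
  case (Suc m)
  then show ?case
    by (simp add: set_mult_assoc assms word_ball_closed)
qed

lemma word_ball_1: "S \<subseteq> carrier G \<Longrightarrow> word_ball G S 1 = S"
  by (force simp: set_mult_def)

lemma word_ball_Suc_right:
  assumes "S \<subseteq> carrier G"
  shows "word_ball G S (Suc n) = word_ball G S n <#> S"
  using word_ball_add[OF assms, of n 1] word_ball_1[OF assms] by simp

lemma one_in_word_ball: "\<one> \<in> S \<Longrightarrow> \<one> \<in> word_ball G S n"
  by (induction n) (force simp: set_mult_def)+

lemma word_ball_mono: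
  assumes "S \<subseteq> carrier G" "\<one> \<in> S" "m \<le> n"
  shows "word_ball G S m \<subseteq> word_ball G S n"
proof
  fix g assume "g \<in> word_ball G S m"
  \<comment> \<open>The factor \<open>\<one>\<close> stands for \<open>n - m\<close> further letters
    that pad the shorter word.\<close>
  moreover have "g = g \<otimes> \<one>"
    using calculation word_ball_closed[OF assms(1), of m] by auto
  ultimately have "g \<in> word_ball G S m <#> word_ball G S (n - m)"
    using one_in_word_ball[OF assms(2)] unfolding set_mult_def by blast
  then show "g \<in> word_ball G S n"
    using word_ball_add[OF assms(1), of m "n - m"] assms(3) by simp
qed

text \<open>Concatenating words of lengths \<open>m\<close> and \<open>n\<close> gives a word of
  length \<open>m + n\<close>, so the balls together are closed under products.\<close>

lemma generate_subset_word_balls: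
  assumes "S \<subseteq> carrier G" "T \<subseteq> S" "m_inv G ` T \<subseteq> S"
  shows "generate G T \<subseteq> (\<Union>n. word_ball G S n)"
proof
  have *: "g \<in> (\<Union>n. word_ball G S n)" if "g \<in> S" for g
    using that word_ball_1[OF assms(1)] by blast
  fix g assume "g \<in> generate G T"
  then show "g \<in> (\<Union>n. word_ball G S n)"
  proof induction
    case one
    have "\<one> \<in> word_ball G S 0" by simp
    then show ?case by blast
  next
    case (incl h)
    then show ?case using assms by (intro *) auto
  next
    case (inv h)
    then show ?case using assms by (intro *) auto
  next
    case (eng h1 h2)
    then obtain m n where "h1 \<in> word_ball G S m" "h2 \<in> word_ball G S n"
      by blast
    then have "h1 \<otimes> h2 \<in> word_ball G S (m + n)"
      unfolding word_ball_add[OF assms(1)] set_mult_def by blast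
    then show ?case by blast
  qed
qed

text \<open>Adjoining the identity makes the balls increase with the radius; adjoining inverses
  allows each letter to be undone by a letter of \<open>S\<close>.\<close>

lemma finite_symmetric_generators:
  assumes "finite T" "T \<subseteq> carrier G" "generate G T = carrier G"
  obtains S where "finite S" "S \<subseteq> carrier G" "\<one> \<in> S" "\<And>s. s \<in> S \<Longrightarrow> inv s \<in> S"
    "(\<Union>n. word_ball G S n) = carrier G"
proof
  let ?S = "{\<one>} \<union> T \<union> m_inv G ` T"
  show "finite ?S" "\<one> \<in> ?S" using assms by auto
  show S: "?S \<subseteq> carrier G" using assms by auto
  show "inv s \<in> ?S" if "s \<in> ?S" for s
    using that assms(2) by (auto simp: subset_iff)
  show "(\<Union>n. word_ball G ?S n) = carrier G"
    using generate_subset_word_balls[OF S, of T] word_ball_closed[OF S] assms(3) by blast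
qed

end

section \<open>Limits of distances\<close>

lemma (in Metric_space) tendsto_dist:
  assumes "limitin mtopology x a F" "limitin mtopology y b F"
  shows "((\<lambda>n. d (x n) (y n)) \<longlongrightarrow> d a b) F"
proof (rule Lim_null[THEN iffD2], rule Lim_null_comparison)
  have "a \<in> M" "b \<in> M"
    using assms by (auto simp: limitin_metric)
  have "eventually (\<lambda>n. x n \<in> M) F" "eventually (\<lambda>n. y n \<in> M) F"
    using assms by (auto simp: limitin_metric_dist_null)
  then show "\<forall>\<^sub>F n in F. norm (d (x n) (y n) - d a b) \<le> d (x n) a + d (y n) b"
  proof eventually_elim
    case (elim n)
    have "d (x n) (y n) \<le> d (x n) a + d a (y n)" "d a (y n) \<le> d a b + d b (y n)"
      "d a b \<le> d a (x n) + d (x n) b" "d (x n) b \<le> d (x n) (y n) + d (y n) b"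
      using elim \<open>a \<in> M\<close> \<open>b \<in> M\<close> by (auto intro: triangle)
    then show ?case
      using commute[of a "x n"] commute[of b "y n"] by simp
  qed
  show "((\<lambda>n. d (x n) a + d (y n) b) \<longlongrightarrow> 0) F"
    using assms by (intro tendsto_add_zero) (simp_all add: limitin_metric_dist_null)
qed

lemma (in Metric_space) compact_pair_sequence:
  fixes x y :: "nat \<Rightarrow> 'a"
  assumes "compact_space mtopology" "range x \<subseteq> M" "range y \<subseteq> M"
  obtains a b r where "a \<in> M" "b \<in> M" "strict_mono (r :: nat \<Rightarrow> nat)"
    "limitin mtopology (x \<circ> r) a sequentially" "limitin mtopology (y \<circ> r) b sequentially"
proof -
  obtain a p where p: "a \<in> M" "strict_mono (p :: nat \<Rightarrow> nat)"
      "limitin mtopology (x \<circ> p) a sequentially"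
    using assms unfolding compact_space_sequentially by blast
  have "range (y \<circ> p) \<subseteq> M"
    using assms by auto
  then obtain b q where q: "b \<in> M" "strict_mono (q :: nat \<Rightarrow> nat)"
      "limitin mtopology (y \<circ> p \<circ> q) b sequentially"
    using assms unfolding compact_space_sequentially by blast
  show thesis
  proof
    show "strict_mono (p \<circ> q)" using p q by (simp add: strict_mono_o)
    show "limitin mtopology (x \<circ> (p \<circ> q)) a sequentially"
      using limitin_subsequence[OF q(2) p(3)] by (simp add: o_assoc)
  qed (use p q in \<open>simp_all add: o_assoc\<close>)
qed

section \<open>Actions on compact metric spaces\<close>

locale compact_metric_action = group G + Metric_space X d
  for G :: "('g, 'm) monoid_scheme" (structure) and X :: "'a set" and d +
  fixes \<phi> :: "'g \<Rightarrow> 'a \<Rightarrow> 'a"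
  assumes compact: "compact_space mtopology"
    and continuous: "g \<in> carrier G \<Longrightarrow> continuous_map mtopology mtopology (\<phi> g)"
    and act_mult: "\<lbrakk>g \<in> carrier G; h \<in> carrier G; x \<in> X\<rbrakk> \<Longrightarrow> \<phi> (g \<otimes> h) x = \<phi> g (\<phi> h x)"
    and act_one: "x \<in> X \<Longrightarrow> \<phi> \<one> x = x"
begin

lemma act_closed: "\<lbrakk>g \<in> carrier G; x \<in> X\<rbrakk> \<Longrightarrow> \<phi> g x \<in> X"
  using continuous_map_funspace[OF continuous[of g]] by auto

lemma act_inv_act: "\<lbrakk>g \<in> carrier G; x \<in> X\<rbrakk> \<Longrightarrow> \<phi> (inv g) (\<phi> g x) = x"
  using act_mult[of "inv g" g x] act_one by simp

lemma tendsto_dist_act: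
  assumes "g \<in> carrier G"
    and "limitin mtopology x a F" "limitin mtopology y b F"
  shows "((\<lambda>n. d (\<phi> g (x n)) (\<phi> g (y n))) \<longlongrightarrow> d (\<phi> g a) (\<phi> g b)) F"
  using tendsto_dist[OF continuous_map_limit continuous_map_limit, OF continuous assms(2)
      continuous assms(3)] assms(1)
  by (simp add: o_def)

text \<open>By compactness a sequence of distinct points has a convergent subsequence. Its
  consecutive terms tend to the same point, so finitely many continuous maps keep them less than
  \<open>c\<close> apart from some index on.\<close>

lemma infinite_imp_close_pair:
  assumes "infinite X" "finite F" "F \<subseteq> carrier G" "c > 0"
  obtains x y where "x \<in> X" "y \<in> X" "x \<noteq> y" "\<forall>g\<in>F. d (\<phi> g x) (\<phi> g y) < c"
proof -
  obtain x :: "nat \<Rightarrow> 'a" where x: "inj x" "range x \<subseteq> X"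
    using assms(1) infinite_countable_subset by blast
  then obtain a r where r: "strict_mono (r :: nat \<Rightarrow> nat)" and a: "a \<in> X"
      "limitin mtopology (x \<circ> r) a sequentially"
    using compact unfolding compact_space_sequentially by blast
  have a': "limitin mtopology (x \<circ> r \<circ> Suc) a sequentially"
    by (rule limitin_subsequence[OF _ a(2)]) (simp add: strict_mono_Suc_iff)
  have lim: "(\<lambda>n. d (\<phi> g (x (r n))) (\<phi> g (x (r (Suc n))))) \<longlonglongrightarrow> d (\<phi> g a) (\<phi> g a)"
    if "g \<in> F" for g
    using tendsto_dist_act[OF _ a(2) a', of g] that assms(3) by (auto simp: o_def)
  have "\<forall>\<^sub>F n in sequentially. \<forall>g\<in>F. d (\<phi> g (x (r n))) (\<phi> g (x (r (Suc n)))) < c"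
  proof (intro eventually_ball_finite assms(2) ballI order_tendstoD(2)[OF lim])
    fix g assume "g \<in> F"
    then show "d (\<phi> g a) (\<phi> g a) < c"
      using assms(3,4) a(1) act_closed by auto
  qed
  then obtain n where "\<forall>g\<in>F. d (\<phi> g (x (r n))) (\<phi> g (x (r (Suc n)))) < c"
    using eventually_happens'[OF sequentially_bot] by blast
  moreover have "x (r n) \<noteq> x (r (Suc n))"
    using x(1) r by (simp add: inj_eq strict_mono_eq)
  ultimately show thesis
    using that x(2) by blast
qed

end

section \<open>Expansive actions of finitely generated groups\<close>

locale fg_expansive_action = compact_metric_action G X d \<phi>
  for G :: "('g, 'm) monoid_scheme" (structure) and X :: "'a set" and d \<phi> +
  fixes S :: "'g set" and c :: real
  assumes S: "finite S" "S \<subseteq> carrier G" "\<one> \<in> S" "\<And>s. s \<in> S \<Longrightarrow> inv s \<in> S"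
    and ex_word_ball: "g \<in> carrier G \<Longrightarrow> \<exists>n. g \<in> word_ball G S n"
    and c_pos: "c > 0"
    and expansive: "\<lbrakk>x \<in> X; y \<in> X; x \<noteq> y\<rbrakk> \<Longrightarrow> \<exists>g\<in>carrier G. d (\<phi> g x) (\<phi> g y) > c"
begin

abbreviation B :: "nat \<Rightarrow> 'g set" where
  "B \<equiv> word_ball G S"

text \<open>This bounds the Bowen metric of the ball by \<open>c\<close>. The bound is non-strict so
  that it survives limits and its failure yields a distance strictly above \<open>c\<close>.\<close>

definition close :: "nat \<Rightarrow> 'a \<Rightarrow> 'a \<Rightarrow> bool" where
  "close n x y \<longleftrightarrow> (\<forall>g\<in>B n. d (\<phi> g x) (\<phi> g y) \<le> c)"

lemma B_closed: "g \<in> B n \<Longrightarrow> g \<in> carrier G"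
  using word_ball_closed S(2) by blast

lemma close_mono: "close n x y \<Longrightarrow> m \<le> n \<Longrightarrow> close m x y"
  using word_ball_mono[OF S(2,3)] unfolding close_def by blast

lemma close_Suc_act:
  assumes "close (Suc n) x y" "s \<in> S" "x \<in> X" "y \<in> X"
  shows "close n (\<phi> s x) (\<phi> s y)"
  unfolding close_def
proof
  fix g assume g: "g \<in> B n"
  then have "g \<otimes> s \<in> B (Suc n)"
    using assms(2) unfolding word_ball_Suc_right[OF S(2)] set_mult_def by blast
  then have "d (\<phi> (g \<otimes> s) x) (\<phi> (g \<otimes> s) y) \<le> c"
    using assms(1) unfolding close_def by blast
  then show "d (\<phi> g (\<phi> s x)) (\<phi> g (\<phi> s y)) \<le> c"
    using g assms S(2) B_closed by (simp add: act_mult subset_iff)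
qed

text \<open>The letter \<open>s\<close> is the one of a separating word that acts first, hence the
  rightmost one.\<close>

lemma not_close_Suc_act:
  assumes "\<not> close (Suc n) x y" "x \<in> X" "y \<in> X"
  obtains s where "s \<in> S" "\<not> close n (\<phi> s x) (\<phi> s y)"
proof -
  obtain g where g: "g \<in> B (Suc n)" "d (\<phi> g x) (\<phi> g y) > c"
    using assms(1) unfolding close_def by force
  then obtain h s where "h \<in> B n" "s \<in> S" "g = h \<otimes> s"
    unfolding word_ball_Suc_right[OF S(2)] set_mult_def by blast
  then have "d (\<phi> h (\<phi> s x)) (\<phi> h (\<phi> s y)) > c"
    using g(2) assms(2,3) S(2) B_closed by (simp add: act_mult subset_iff)
  then show thesis
    using that \<open>h \<in> B n\<close> \<open>s \<in> S\<close> unfolding close_def by force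
qed

lemma ex_not_close:
  assumes "x \<in> X" "y \<in> X" "x \<noteq> y"
  shows "\<exists>n. \<not> close n x y"
  using expansive[OF assms] ex_word_ball unfolding close_def by (meson not_le)

text \<open>The conjunct \<open>x = \<phi> h u\<close> serves only the induction: it provides the case \<open>k = n\<close> of the
  last conjunct.\<close>

lemma separated_pair_near_close_pairs:
  assumes "x \<in> X" "y \<in> X" "close n x y" "\<not> close (Suc n) x y"
  shows "\<exists>u\<in>X. \<exists>v\<in>X. d u v > c \<and> (\<exists>h\<in>B (Suc n). x = \<phi> h u \<and> y = \<phi> h v) \<and>
    (\<forall>k\<le>n. \<exists>h\<in>B (Suc k). close k (\<phi> h u) (\<phi> h v))"
  using assms
proof (induction n arbitrary: x y)
  case 0
  obtain s where s: "s \<in> S" "\<not> close 0 (\<phi> s x) (\<phi> s y)"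
    using not_close_Suc_act 0 by metis
  \<comment> \<open>The pair sought is the image of \<open>x\<close>, \<open>y\<close> under
    \<open>s\<close>; the only letter to undo is \<open>s\<close> itself.\<close>
  have "s \<in> carrier G" "inv s \<in> B (Suc 0)"
    using s S(2,4) word_ball_1[OF S(2)] by auto
  moreover have "x = \<phi> (inv s) (\<phi> s x)" "y = \<phi> (inv s) (\<phi> s y)"
    using calculation 0 act_inv_act by auto
  moreover have "d (\<phi> s x) (\<phi> s y) > c"
    using s(2) calculation 0 act_closed act_one by (simp add: close_def)
  moreover have "\<exists>h\<in>B (Suc 0). close 0 (\<phi> h (\<phi> s x)) (\<phi> h (\<phi> s y))"
    using calculation 0 by metis
  ultimately show ?case
    using 0 act_closed by (metis le_zero_eq)
next
  case (Suc n)
  obtain s where s: "s \<in> S" "\<not> close (Suc n) (\<phi> s x) (\<phi> s y)"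
    using not_close_Suc_act Suc.prems by metis
  have sG: "s \<in> carrier G" using s S(2) by blast
  \<comment> \<open>Both radii drop by exactly one: the image pair is \<open>n\<close>-close and, by
    the choice of \<open>s\<close>, not \<open>Suc n\<close>-close, as the induction hypothesis
    requires.\<close>
  have "close n (\<phi> s x) (\<phi> s y)"
    using close_Suc_act Suc.prems s by blast
  from Suc.IH[OF act_closed[OF sG] act_closed[OF sG] this s(2)] Suc.prems
  obtain u v h where uv: "u \<in> X" "v \<in> X" "d u v > c"
    and h: "h \<in> B (Suc n)" "\<phi> s x = \<phi> h u" "\<phi> s y = \<phi> h v"
    and k: "\<And>k. k \<le> n \<Longrightarrow> \<exists>h\<in>B (Suc k). close k (\<phi> h u) (\<phi> h v)"
    by blast
  \<comment> \<open>Here \<open>h\<close> leads from \<open>u\<close>, \<open>v\<close> back to the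
    images of \<open>x\<close>, \<open>y\<close>, and \<open>inv s\<close> from there to
    \<open>x\<close>, \<open>y\<close>. This word settles \<open>k = Suc n\<close>; smaller
    \<open>k\<close> come from the induction hypothesis.\<close>
  have h': "inv s \<otimes> h \<in> B (Suc (Suc n))"
    using h(1) S(4)[OF s(1)] unfolding word_ball.simps(2)[of G S "Suc n"] set_mult_def by blast
  have eq: "x = \<phi> (inv s \<otimes> h) u" "y = \<phi> (inv s \<otimes> h) v"
    using act_mult[OF inv_closed[OF sG] B_closed[OF h(1)]] uv(1,2) h(2,3)[symmetric]
      act_inv_act[OF sG] Suc.prems(1,2) by simp_all
  have "\<exists>h\<in>B (Suc k). close k (\<phi> h u) (\<phi> h v)" if "k \<le> Suc n" for k
  proof (cases "k = Suc n")
    case True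
    then show ?thesis using h' eq Suc.prems by metis
  next
    case False
    then show ?thesis using k that by simp
  qed
  then show ?case using uv h' eq by blast
qed

text \<open>Otherwise pairs that are \<open>k\<close>-close for larger and larger \<open>k\<close>
  but at least \<epsilon> apart would accumulate at two distinct points that no group element moves
  more than \<open>c\<close> apart, against expansivity.\<close>

lemma close_imp_uniformly_near:
  assumes "\<epsilon> > 0"
  obtains k where "\<And>x y. \<lbrakk>x \<in> X; y \<in> X; close k x y\<rbrakk> \<Longrightarrow> d x y < \<epsilon>"
proof (rule ccontr)
  assume "\<not> thesis"
  then have "\<forall>k. \<exists>x y. x \<in> X \<and> y \<in> X \<and> close k x y \<and> d x y \<ge> \<epsilon>"
    using that by (meson not_le)
  then obtain x y where xy: "\<And>k. x k \<in> X" "\<And>k. y k \<in> X" "\<And>k. close k (x k) (y k)"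
      "\<And>k. d (x k) (y k) \<ge> \<epsilon>"
    by metis
  obtain a b r where r: "a \<in> X" "b \<in> X" "strict_mono (r :: nat \<Rightarrow> nat)"
    "limitin mtopology (x \<circ> r) a sequentially" "limitin mtopology (y \<circ> r) b sequentially"
    using compact_pair_sequence[OF compact, of x y] xy by blast
  have "d a b \<ge> \<epsilon>"
    by (rule tendsto_lowerbound[OF tendsto_dist[OF r(4,5)]]) (use xy in auto)
  then have "a \<noteq> b" using r assms by auto
  then obtain k where "\<not> close k a b" using ex_not_close r by blast
  then obtain g where g: "g \<in> B k" "d (\<phi> g a) (\<phi> g b) > c"
    unfolding close_def by force
  \<comment> \<open>Since \<open>n \<le> r n\<close>, the pair at index \<open>r n\<close> is
    \<open>k\<close>-close as soon as \<open>k \<le> n\<close>.\<close>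
  have "d (\<phi> g (x (r n))) (\<phi> g (y (r n))) \<le> c" if "n \<ge> k" for n
    using close_mono[OF xy(3), of k] order_trans[OF that seq_suble[OF r(3)]] g(1)
    unfolding close_def by blast
  then have "\<forall>\<^sub>F n in sequentially. d (\<phi> g ((x \<circ> r) n)) (\<phi> g ((y \<circ> r) n)) \<le> c"
    by (auto simp: eventually_sequentially)
  from tendsto_upperbound[OF tendsto_dist_act[OF B_closed[OF g(1)] r(4,5)] this]
  show False using g by simp
qed

text \<open>A distinct \<open>n\<close>-close pair ceases, by expansivity, to be close at some first
  radius \<open>m > n\<close>. With \<open>l = m - 1\<close> it is \<open>l\<close>-close but not
  \<open>Suc l\<close>-close, and \<open>k \<le> n\<close> implies \<open>k \<le> l\<close>.\<close>

lemma infinite_imp_separated_pair: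
  assumes "infinite X"
  obtains u v where "u \<in> X" "v \<in> X" "d u v > c"
    "\<And>k. k \<le> n \<Longrightarrow> \<exists>h\<in>B (Suc k). close k (\<phi> h u) (\<phi> h v)"
proof -
  obtain x y where xy: "x \<in> X" "y \<in> X" "x \<noteq> y" "close n x y"
    using infinite_imp_close_pair[OF assms finite_word_ball[OF S(1)] word_ball_closed[OF S(2)] c_pos]
    unfolding close_def by (metis less_imp_le)
  define m where "m = (LEAST m. \<not> close m x y)"
  have m: "\<not> close m x y" "\<And>k. k < m \<Longrightarrow> close k x y"
    using LeastI_ex[OF ex_not_close[OF xy(1-3)]] not_less_Least unfolding m_def by auto
  have "n < m" using close_mono[OF xy(4)] m(1) not_le by blast
  then obtain l where "m = Suc l" "n \<le> l" by (cases m) auto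
  then show thesis
    using separated_pair_near_close_pairs[OF xy(1,2), of l] m that by (meson lessI order_trans)
qed

theorem infinite_imp_proximal_pair:
  assumes "infinite X"
  obtains a b where "a \<in> X" "b \<in> X" "a \<noteq> b"
    "\<And>\<delta>. \<delta> > 0 \<Longrightarrow> \<exists>g\<in>carrier G. d (\<phi> g a) (\<phi> g b) < \<delta>"
proof -
  have "\<forall>n. \<exists>u v. u \<in> X \<and> v \<in> X \<and> d u v > c \<and>
      (\<forall>k\<le>n. \<exists>h\<in>B (Suc k). close k (\<phi> h u) (\<phi> h v))"
    using infinite_imp_separated_pair[OF assms] by metis
  then obtain u v where uv: "\<And>n. u n \<in> X" "\<And>n. v n \<in> X" "\<And>n. d (u n) (v n) > c"
    and near: "\<And>n k. k \<le> n \<Longrightarrow> \<exists>h\<in>B (Suc k). close k (\<phi> h (u n)) (\<phi> h (v n))"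
    by metis
  obtain a b r where r: "a \<in> X" "b \<in> X" "strict_mono (r :: nat \<Rightarrow> nat)"
    "limitin mtopology (u \<circ> r) a sequentially" "limitin mtopology (v \<circ> r) b sequentially"
    using compact_pair_sequence[OF compact, of u v] uv by blast
  \<comment> \<open>The strict bound weakens in the limit, but \<open>c > 0\<close> still keeps
    \<open>a\<close> and \<open>b\<close> apart.\<close>
  have "d a b \<ge> c"
    by (rule tendsto_lowerbound[OF tendsto_dist[OF r(4,5)]]) (simp_all add: uv less_imp_le)
  then have "a \<noteq> b" using r c_pos by auto
  moreover have "\<exists>g\<in>carrier G. d (\<phi> g a) (\<phi> g b) < \<delta>" if "\<delta> > 0" for \<delta>
  proof (rule ccontr)
    assume far: "\<not> ?thesis"
    \<comment> \<open>This \<open>k\<close> depends on \<delta> alone, so one finite ball serves all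
      \<open>n\<close>. Halving \<delta> leaves room for a strict inequality to pass from the limit
      pair to the pairs converging to it.\<close>
    obtain k where k: "\<And>x y. \<lbrakk>x \<in> X; y \<in> X; close k x y\<rbrakk> \<Longrightarrow> d x y < \<delta> / 2"
      using close_imp_uniformly_near[of "\<delta> / 2"] \<open>\<delta> > 0\<close> by (metis half_gt_zero)
    have "\<forall>\<^sub>F n in sequentially. \<forall>h\<in>B (Suc k). \<delta> / 2 < d (\<phi> h ((u \<circ> r) n)) (\<phi> h ((v \<circ> r) n))"
    proof (intro eventually_ball_finite finite_word_ball S(1) ballI)
      fix h assume "h \<in> B (Suc k)"
      then have h: "h \<in> carrier G" by (rule B_closed)
      have "\<delta> / 2 < d (\<phi> h a) (\<phi> h b)" using far h \<open>\<delta> > 0\<close> by force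
      then show "\<forall>\<^sub>F n in sequentially. \<delta> / 2 < d (\<phi> h ((u \<circ> r) n)) (\<phi> h ((v \<circ> r) n))"
        by (rule order_tendstoD(1)[OF tendsto_dist_act[OF h r(4,5)]])
    qed
    then obtain n where n: "n \<ge> k"
        "\<forall>h\<in>B (Suc k). \<delta> / 2 < d (\<phi> h (u (r n))) (\<phi> h (v (r n)))"
      unfolding eventually_sequentially by (metis comp_apply linear)
    then obtain h where h: "h \<in> B (Suc k)" "close k (\<phi> h (u (r n))) (\<phi> h (v (r n)))"
      using near[of k "r n"] order_trans[OF n(1) seq_suble[OF r(3)]] by blast
    then have "d (\<phi> h (u (r n))) (\<phi> h (v (r n))) < \<delta> / 2"
      using k act_closed[OF B_closed[OF h(1)]] uv by blast
    then show False using n h by force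
  qed
  ultimately show thesis using that r by blast
qed

end

section \<open>Homomorphisms into the homeomorphism group, and the contradiction with
  distality\<close>

lemma continuous_action_compact_metric_action:
  assumes "Metric_space X d" "compact_space (Metric_space.mtopology X d)"
    and "continuous_action G (Metric_space.mtopology X d) \<phi>"
  shows "compact_metric_action G X d \<phi>"
proof -
  interpret Metric_space X d by fact
  interpret group G using assms(3) by (simp add: continuous_action_def)
  have hom: "\<phi> \<in> hom G (homeo_group mtopology)"
    using assms(3) by (simp add: continuous_action_def)
  have Bij: "\<phi> g \<in> Bij X" and homeo: "homeomorphic_map mtopology mtopology (\<phi> g)"
    if "g \<in> carrier G" for g
    using hom that by (auto simp: hom_def homeo_group_def Pi_iff)
  have mult: "\<phi> (g \<otimes>\<^bsub>G\<^esub> h) x = \<phi> g (\<phi> h x)"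
    if "g \<in> carrier G" "h \<in> carrier G" "x \<in> X" for g h x
    using hom that Bij
    by (simp add: hom_def homeo_group_def BijGroup_def compose_def)
  \<comment> \<open>The identity of the group acts as an idempotent injective map on
    \<open>X\<close>, hence as the identity map there.\<close>
  have one: "\<phi> \<one>\<^bsub>G\<^esub> x = x" if "x \<in> X" for x
  proof -
    have "bij_betw (\<phi> \<one>\<^bsub>G\<^esub>) X X"
      using Bij[OF one_closed] by (simp add: Bij_def)
    then show ?thesis
      using mult[OF one_closed one_closed that] that
      by (metis bij_betwE bij_betw_imp_inj_on inj_on_eq_iff l_one one_closed)
  qed
  show ?thesis
    by unfold_locales (use assms(2) mult one homeomorphic_imp_continuous_map[OF homeo] in auto)
qed

theorem theorem1p1:
  fixes G :: "('g, 'm) monoid_scheme"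
    and X :: "'a set"
    and d :: "'a \<Rightarrow> 'a \<Rightarrow> real"
    and \<phi> :: "'g \<Rightarrow> 'a \<Rightarrow> 'a"
  assumes "finitely_generated_group G"
    and "Metric_space X d"
    and "compact_space (Metric_space.mtopology X d)"
    and "continuous_action G (Metric_space.mtopology X d) \<phi>"
    and "distal_action G X d \<phi>"
    and "expansive_action G X d \<phi>"
  shows "finite X"
proof (rule ccontr)
  assume "infinite X"
  interpret compact_metric_action G X d \<phi>
    using assms by (intro continuous_action_compact_metric_action)
  obtain T where T: "finite T" "T \<subseteq> carrier G" "generate G T = carrier G"
    using assms(1) by (auto simp: finitely_generated_group_def)
  obtain S where S: "finite S" "S \<subseteq> carrier G" "\<one>\<^bsub>G\<^esub> \<in> S" "\<And>s. s \<in> S \<Longrightarrow> inv\<^bsub>G\<^esub> s \<in> S"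
    "(\<Union>n. word_ball G S n) = carrier G"
    using finite_symmetric_generators[OF T] by blast
  obtain c where c: "c > 0" "\<And>x y. \<lbrakk>x \<in> X; y \<in> X; x \<noteq> y\<rbrakk> \<Longrightarrow>
      (SUP g\<in>carrier G. d (\<phi> g x) (\<phi> g y)) > c"
    using assms(6) unfolding expansive_action_def by blast
  have ne: "carrier G \<noteq> {}" using one_closed by blast
  \<comment> \<open>If every distance were at most \<open>c\<close>, so would be the supremum over
    the nonempty carrier.\<close>
  have exp: "\<exists>g\<in>carrier G. d (\<phi> g x) (\<phi> g y) > c" if "x \<in> X" "y \<in> X" "x \<noteq> y" for x y
    using c(2)[OF that] cSUP_least[OF ne, of "\<lambda>g. d (\<phi> g x) (\<phi> g y)" c] by (meson not_le)
  interpret fg_expansive_action G X d \<phi> S c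
    by unfold_locales (use S c(1) exp in auto)
  obtain a b where ab: "a \<in> X" "b \<in> X" "a \<noteq> b"
      "\<And>\<delta>. \<delta> > 0 \<Longrightarrow> \<exists>g\<in>carrier G. d (\<phi> g a) (\<phi> g b) < \<delta>"
    using infinite_imp_proximal_pair[OF \<open>infinite X\<close>] by blast
  have "(INF g\<in>carrier G. d (\<phi> g a) (\<phi> g b)) > 0" (is "?I > 0")
    using assms(5) ab unfolding distal_action_def by blast
  \<comment> \<open>The positive infimum itself serves as \<delta>. Distances are bounded below by
    0, so this real infimum is a genuine lower bound, which gives the contradiction.\<close>
  then obtain g where g: "g \<in> carrier G" "d (\<phi> g a) (\<phi> g b) < ?I"
    using ab(4) by blast
  moreover have "?I \<le> d (\<phi> g a) (\<phi> g b)"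
    by (rule cINF_lower[OF bdd_belowI2[where m = 0] g(1)]) simp
  ultimately show False by simp
qed

end
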